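(* Let $\Omega\subset\mathbb{C}$ be a nonempty simply connected domain and fix $\zeta_0\in\Omega$. Then the set $\mathcal{D}$ of all functions $f\in\mathcal{H}ol(\Omega)$ with the property that $f^{(k)}$ is unbounded on $\Omega$ for all $k\in\mathbb{Z}$ is a dense $G_\delta$ subset of $\mathcal{H}ol(\Omega)$.
   Context: $\mathcal{H}ol(\Omega)$ is the space of all holomorphic functions on $\Omega$ with the topology of uniform convergence on compact subsets of $\Omega$. A domain is an open connected subset of $\mathbb{C}$. A $G_\delta$ set is a countable intersection of open sets. For $f\in\mathcal{H}ol(\Omega)$ define $T(f)(z)=T^{(1)}(f)(z)=\int_{\gamma_z}f(\xi)\,d\xi$ for $z\in\Omega$, where $\gamma_z$ is any polygonal line in $\Omega$ starting at $\zeta_0$ and ending at $z$, and $T^{(k)}(f)(z)=\int_{\gamma_z}T^{(k-1)}(f)(\xi)\,d\xi$ for $k\ge 2$ (well defined since $\Omega$ is simply connected). For $k\in\mathbb{Z}$, $f^{(k)}$ denotes the $k$-th derivative of $f$ if $k>0$, $f$ itself if $k=0$, and $T^{(-k)}(f)$ if $k<0$. *)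

theory Defs
  imports "HOL-Complex_Analysis.Complex_Analysis"
begin

text \<open>
  Functions are total in HOL, so a function on \<open>\<Omega>\<close> is represented by the unique
  total function that agrees with it on \<open>\<Omega>\<close> and is extensional (\<open>undefined\<close> outside).
\<close>

definition Hol :: "complex set \<Rightarrow> (complex \<Rightarrow> complex) set" where
  "Hol \<Omega> = {f \<in> extensional \<Omega>. f holomorphic_on \<Omega>}"

definition basic_nbhd ::
    "complex set \<Rightarrow> (complex \<Rightarrow> complex) \<Rightarrow> complex set \<Rightarrow> real \<Rightarrow> (complex \<Rightarrow> complex) set" where
  "basic_nbhd \<Omega> f K e = {g \<in> Hol \<Omega>. \<forall>z\<in>K. dist (f z) (g z) < e}"

definition Hol_topology :: "complex set \<Rightarrow> (complex \<Rightarrow> complex) topology" where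
  "Hol_topology \<Omega> = topology (\<lambda>U. U \<subseteq> Hol \<Omega> \<and>
     (\<forall>f\<in>U. \<exists>K e. compact K \<and> K \<subseteq> \<Omega> \<and> e > 0 \<and> basic_nbhd \<Omega> f K e \<subseteq> U))"

inductive polygonal_path :: "(real \<Rightarrow> complex) \<Rightarrow> bool" where
  segment: "polygonal_path (linepath a b)"
| join: "polygonal_path g \<Longrightarrow> pathfinish g = a \<Longrightarrow> polygonal_path (g +++ linepath a b)"

definition polygonal_from_to ::
    "complex set \<Rightarrow> complex \<Rightarrow> complex \<Rightarrow> (real \<Rightarrow> complex) \<Rightarrow> bool" where
  "polygonal_from_to \<Omega> a b g \<longleftrightarrow>
     polygonal_path g \<and> path_image g \<subseteq> \<Omega> \<and> pathstart g = a \<and> pathfinish g = b"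

text \<open>
  On simply connected domains any polygonal line gives the same value and the result is again
  holomorphic, so that the operator can be iterated; see \<open>T_op_eq_contour_integral\<close> and
  \<open>T_op_has_field_derivative\<close> below. Values at points outside \<open>\<Omega>\<close> carry no meaning.
\<close>

definition T_op ::
    "complex set \<Rightarrow> complex \<Rightarrow> (complex \<Rightarrow> complex) \<Rightarrow> complex \<Rightarrow> complex" where
  "T_op \<Omega> \<zeta>0 f z = contour_integral (SOME g. polygonal_from_to \<Omega> \<zeta>0 z g) f"

definition int_deriv ::
    "complex set \<Rightarrow> complex \<Rightarrow> int \<Rightarrow> (complex \<Rightarrow> complex) \<Rightarrow> complex \<Rightarrow> complex" where
  "int_deriv \<Omega> \<zeta>0 k f =
     (if k \<ge> 0 then (deriv ^^ nat k) f else (T_op \<Omega> \<zeta>0 ^^ nat (- k)) f)"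

definition unbounded_all_orders :: "complex set \<Rightarrow> complex \<Rightarrow> (complex \<Rightarrow> complex) set" where
  "unbounded_all_orders \<Omega> \<zeta>0 =
     {f \<in> Hol \<Omega>. \<forall>k. \<not> bounded (int_deriv \<Omega> \<zeta>0 k f ` \<Omega>)}"

lemma openin_Hol_topology:
  "openin (Hol_topology \<Omega>) U \<longleftrightarrow> U \<subseteq> Hol \<Omega> \<and>
     (\<forall>f\<in>U. \<exists>K e. compact K \<and> K \<subseteq> \<Omega> \<and> e > 0 \<and> basic_nbhd \<Omega> f K e \<subseteq> U)"
proof -
  define P where "P U \<longleftrightarrow> U \<subseteq> Hol \<Omega> \<and>
     (\<forall>f\<in>U. \<exists>K e. compact K \<and> K \<subseteq> \<Omega> \<and> e > 0 \<and> basic_nbhd \<Omega> f K e \<subseteq> U)" for U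
  have Int: "P (S \<inter> T)" if S: "P S" and T: "P T" for S T
    unfolding P_def
  proof (intro conjI ballI)
    show "S \<inter> T \<subseteq> Hol \<Omega>" using S by (auto simp: P_def)
    fix f assume f: "f \<in> S \<inter> T"
    obtain K d where 1: "compact K" "K \<subseteq> \<Omega>" "d > 0" "basic_nbhd \<Omega> f K d \<subseteq> S"
      using S f unfolding P_def by blast
    obtain L e where 2: "compact L" "L \<subseteq> \<Omega>" "e > 0" "basic_nbhd \<Omega> f L e \<subseteq> T"
      using T f unfolding P_def by blast
    have "basic_nbhd \<Omega> f (K \<union> L) (min d e) \<subseteq> basic_nbhd \<Omega> f K d \<inter> basic_nbhd \<Omega> f L e"
      by (auto simp: basic_nbhd_def)
    then have "basic_nbhd \<Omega> f (K \<union> L) (min d e) \<subseteq> S \<inter> T"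
      using 1(4) 2(4) by blast
    moreover have "compact (K \<union> L)" "K \<union> L \<subseteq> \<Omega>" "min d e > 0"
      using 1 2 by auto
    ultimately show "\<exists>K e. compact K \<and> K \<subseteq> \<Omega> \<and> e > 0 \<and> basic_nbhd \<Omega> f K e \<subseteq> S \<inter> T"
      by metis
  qed
  have Un: "P (\<Union>\<U>)" if *: "\<forall>U\<in>\<U>. P U" for \<U>
    unfolding P_def
  proof (intro conjI ballI)
    show "\<Union>\<U> \<subseteq> Hol \<Omega>" using * by (auto simp: P_def)
    fix f assume "f \<in> \<Union>\<U>"
    then obtain U where U: "U \<in> \<U>" "f \<in> U" by blast
    have "P U" using * U(1) by blast
    then obtain K e where K: "compact K" "K \<subseteq> \<Omega>" "e > 0" "basic_nbhd \<Omega> f K e \<subseteq> U"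
      using U(2) unfolding P_def by blast
    then have "basic_nbhd \<Omega> f K e \<subseteq> \<Union>\<U>" using U(1) by blast
    with K(1-3) show "\<exists>K e. compact K \<and> K \<subseteq> \<Omega> \<and> e > 0 \<and> basic_nbhd \<Omega> f K e \<subseteq> \<Union>\<U>"
      by (intro exI[of _ K] exI[of _ e] conjI)
  qed
  have "istopology P"
    unfolding istopology_def using Int Un by simp
  moreover have "Hol_topology \<Omega> = topology P"
    unfolding Hol_topology_def P_def ..
  ultimately have "openin (Hol_topology \<Omega>) U \<longleftrightarrow> P U"
    by (simp add: topology_inverse')
  then show ?thesis unfolding P_def .
qed

lemma topspace_Hol_topology [simp]: "topspace (Hol_topology \<Omega>) = Hol \<Omega>"
proof
  show "topspace (Hol_topology \<Omega>) \<subseteq> Hol \<Omega>"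
    unfolding topspace_def openin_Hol_topology by blast
  have "openin (Hol_topology \<Omega>) (Hol \<Omega>)"
    unfolding openin_Hol_topology
    by (intro conjI ballI exI[of _ "{}"] exI[of _ 1]) (auto simp: basic_nbhd_def)
  then show "Hol \<Omega> \<subseteq> topspace (Hol_topology \<Omega>)"
    by (rule openin_subset)
qed

lemma openin_basic_nbhd:
  assumes f: "f \<in> Hol \<Omega>" and K: "compact K" "K \<subseteq> \<Omega>"
  shows "openin (Hol_topology \<Omega>) (basic_nbhd \<Omega> f K e)"
  unfolding openin_Hol_topology
proof (intro conjI ballI)
  show "basic_nbhd \<Omega> f K e \<subseteq> Hol \<Omega>" by (auto simp: basic_nbhd_def)
  fix g assume g: "g \<in> basic_nbhd \<Omega> f K e"
  have "\<exists>d>0. \<forall>z\<in>K. dist (f z) (g z) + d \<le> e"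
  proof (cases "K = {}")
    case True then show ?thesis by (auto intro: exI[of _ 1])
  next
    case False
    have "continuous_on K f" "continuous_on K g"
      using f g K by (auto simp: basic_nbhd_def Hol_def
          intro: holomorphic_on_imp_continuous_on continuous_on_subset)
    then have "continuous_on K (\<lambda>z. dist (f z) (g z))"
      by (intro continuous_intros)
    then obtain w where w: "w \<in> K" "\<forall>z\<in>K. dist (f z) (g z) \<le> dist (f w) (g w)"
      using continuous_attains_sup[OF K(1) False] by blast
    then show ?thesis
      using g by (intro exI[of _ "e - dist (f w) (g w)"]) (auto simp: basic_nbhd_def)
  qed
  then obtain d where d: "d > 0" "\<forall>z\<in>K. dist (f z) (g z) + d \<le> e" by blast
  have "basic_nbhd \<Omega> g K d \<subseteq> basic_nbhd \<Omega> f K e"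
  proof
    fix h assume h: "h \<in> basic_nbhd \<Omega> g K d"
    have "dist (f z) (h z) < e" if "z \<in> K" for z
    proof -
      have "dist (g z) (h z) < d" using h that by (auto simp: basic_nbhd_def)
      then show ?thesis
        using d(2) that dist_triangle[of "f z" "h z" "g z"] by fastforce
    qed
    then show "h \<in> basic_nbhd \<Omega> f K e" using h by (auto simp: basic_nbhd_def)
  qed
  then show "\<exists>L d. compact L \<and> L \<subseteq> \<Omega> \<and> d > 0 \<and> basic_nbhd \<Omega> g L d \<subseteq> basic_nbhd \<Omega> f K e"
    using K d by blast
qed

lemma limitin_Hol_topology:
  assumes "\<And>x. F x \<in> Hol \<Omega>" "f \<in> Hol \<Omega>"
  shows "limitin (Hol_topology \<Omega>) F f \<F> \<longleftrightarrow>
     (\<forall>K. compact K \<and> K \<subseteq> \<Omega> \<longrightarrow> uniform_limit K F f \<F>)"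
proof
  assume L: "limitin (Hol_topology \<Omega>) F f \<F>"
  show "\<forall>K. compact K \<and> K \<subseteq> \<Omega> \<longrightarrow> uniform_limit K F f \<F>"
    unfolding uniform_limit_iff
  proof (intro allI impI)
    fix K and e :: real assume K: "compact K \<and> K \<subseteq> \<Omega>" and "e > 0"
    then have "f \<in> basic_nbhd \<Omega> f K e" using assms by (auto simp: basic_nbhd_def)
    then have "\<forall>\<^sub>F x in \<F>. F x \<in> basic_nbhd \<Omega> f K e"
      using L openin_basic_nbhd[OF assms(2)] K by (auto simp: limitin_def)
    then show "\<forall>\<^sub>F n in \<F>. \<forall>x\<in>K. dist (F n x) (f x) < e"
      by eventually_elim (auto simp: basic_nbhd_def dist_commute)
  qed
next
  assume R: "\<forall>K. compact K \<and> K \<subseteq> \<Omega> \<longrightarrow> uniform_limit K F f \<F>"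
  show "limitin (Hol_topology \<Omega>) F f \<F>"
    unfolding limitin_def
  proof (intro conjI allI impI)
    show "f \<in> topspace (Hol_topology \<Omega>)" using assms by simp
    fix U assume "openin (Hol_topology \<Omega>) U \<and> f \<in> U"
    then obtain K e where K: "compact K" "K \<subseteq> \<Omega>" "e > 0" "basic_nbhd \<Omega> f K e \<subseteq> U"
      unfolding openin_Hol_topology by blast
    then have "\<forall>\<^sub>F n in \<F>. \<forall>x\<in>K. dist (F n x) (f x) < e"
      using R by (auto simp: uniform_limit_iff)
    then show "\<forall>\<^sub>F x in \<F>. F x \<in> U"
      by eventually_elim (use K(4) assms(1) in \<open>auto simp: basic_nbhd_def dist_commute\<close>)
  qed
qed

lemma polygonal_path_valid: "polygonal_path g \<Longrightarrow> valid_path g"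
  by (induction rule: polygonal_path.induct) (auto intro: valid_path_join)

lemma polygonal_from_to_exists:
  assumes "open \<Omega>" "connected \<Omega>" "a \<in> \<Omega>" "b \<in> \<Omega>"
  shows "\<exists>g. polygonal_from_to \<Omega> a b g"
proof -
  define R where "R = {z. \<exists>g. polygonal_from_to \<Omega> a z g}"
  have ext: "w \<in> R" if z: "z \<in> R" and zw: "closed_segment z w \<subseteq> \<Omega>" for z w
  proof -
    obtain g where g: "polygonal_from_to \<Omega> a z g" using z unfolding R_def by blast
    then have "polygonal_from_to \<Omega> a w (g +++ linepath z w)"
      using zw by (auto simp: polygonal_from_to_def path_image_join intro: polygonal_path.join)
    then show ?thesis unfolding R_def by blast
  qed
  have "polygonal_from_to \<Omega> a a (linepath a a)"
    using assms by (auto simp: polygonal_from_to_def intro: polygonal_path.segment)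
  then have aR: "a \<in> R" unfolding R_def by blast
  have seg: "closed_segment z w \<subseteq> \<Omega>" "closed_segment w z \<subseteq> \<Omega>"
    if "ball z e \<subseteq> \<Omega>" "w \<in> ball z e" for z w e
  proof -
    have "z \<in> ball z e" using that(2) by (metis ball_eq_empty centre_in_ball empty_iff not_le)
    then have "closed_segment z w \<subseteq> ball z e"
      using that(2) by (intro closed_segment_subset) auto
    then show "closed_segment z w \<subseteq> \<Omega>" using that by blast
    then show "closed_segment w z \<subseteq> \<Omega>" by (simp add: closed_segment_commute)
  qed
  have nb: "\<exists>e>0. ball z e \<subseteq> \<Omega>" if "z \<in> \<Omega>" for z
    using assms(1) that open_contains_ball by blast
  have "open (\<Omega> \<inter> R)"
    unfolding open_contains_ball
  proof
    fix z assume z: "z \<in> \<Omega> \<inter> R"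
    then obtain e where "e > 0" "ball z e \<subseteq> \<Omega>" using nb by blast
    then show "\<exists>e>0. ball z e \<subseteq> \<Omega> \<inter> R" using z seg(1) ext by blast
  qed
  moreover have "open (\<Omega> - R)"
    unfolding open_contains_ball
  proof
    fix z assume z: "z \<in> \<Omega> - R"
    then obtain e where "e > 0" "ball z e \<subseteq> \<Omega>" using nb by blast
    then show "\<exists>e>0. ball z e \<subseteq> \<Omega> - R" using z seg(2) ext by blast
  qed
  ultimately have "\<Omega> \<inter> R = {} \<or> \<Omega> - R = {}"
    using connectedD[OF assms(2), of "\<Omega> \<inter> R" "\<Omega> - R"] by blast
  then have "b \<in> R" using aR assms by blast
  then show ?thesis unfolding R_def by blast
qed

lemma contour_integral_polygonal:
  assumes "\<And>x. x \<in> \<Omega> \<Longrightarrow> (h has_field_derivative f x) (at x)" "polygonal_from_to \<Omega> a b g"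
  shows "contour_integral g f = h b - h a"
proof -
  have g: "valid_path g" "path_image g \<subseteq> \<Omega>" "pathstart g = a" "pathfinish g = b"
    using assms(2) polygonal_path_valid by (simp_all add: polygonal_from_to_def)
  have "(f has_contour_integral h (pathfinish g) - h (pathstart g)) g"
    by (rule contour_integral_primitive[OF _ g(1,2)]) (rule has_field_derivative_at_within[OF assms(1)])
  then show ?thesis using g by (simp add: contour_integral_unique)
qed

lemma T_op_primitive:
  assumes "\<And>x. x \<in> \<Omega> \<Longrightarrow> (h has_field_derivative f x) (at x)" "polygonal_from_to \<Omega> \<zeta>0 z g"
  shows "T_op \<Omega> \<zeta>0 f z = h z - h \<zeta>0"
  unfolding T_op_def
  by (rule contour_integral_polygonal[OF assms(1) someI[of "polygonal_from_to \<Omega> \<zeta>0 z", OF assms(2)]])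

lemma T_op_eq_contour_integral:
  assumes "open \<Omega>" "simply_connected \<Omega>" "f holomorphic_on \<Omega>"
    and g: "polygonal_from_to \<Omega> \<zeta>0 z g"
  shows "T_op \<Omega> \<zeta>0 f z = contour_integral g f"
proof -
  obtain h where h: "\<And>x. x \<in> \<Omega> \<Longrightarrow> (h has_field_derivative f x) (at x)"
    using iffD1[OF simply_connected_eq_global_primitive[OF assms(1)] assms(2)] assms(3) by blast
  show ?thesis
    using T_op_primitive[OF h g] contour_integral_polygonal[OF h g] by simp
qed

lemma T_op_has_field_derivative:
  assumes "open \<Omega>" "simply_connected \<Omega>" "\<zeta>0 \<in> \<Omega>" "f holomorphic_on \<Omega>" "z \<in> \<Omega>"
  shows "(T_op \<Omega> \<zeta>0 f has_field_derivative f z) (at z)"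
proof -
  obtain h where h: "\<And>x. x \<in> \<Omega> \<Longrightarrow> (h has_field_derivative f x) (at x)"
    using iffD1[OF simply_connected_eq_global_primitive[OF assms(1)] assms(2)] assms(4) by blast
  have eq: "h w - h \<zeta>0 = T_op \<Omega> \<zeta>0 f w" if w: "w \<in> \<Omega>" for w
  proof -
    obtain g where "polygonal_from_to \<Omega> \<zeta>0 w g"
      using polygonal_from_to_exists[OF assms(1) simply_connected_imp_connected[OF assms(2)] assms(3) w]
      by blast
    then show ?thesis using T_op_primitive[OF h] by simp
  qed
  have "((\<lambda>w. h w - h \<zeta>0) has_field_derivative f z) (at z)"
    using h[OF assms(5)] by (auto intro!: derivative_eq_intros)
  then show ?thesis
    by (rule has_field_derivative_transform_within_open[OF _ assms(1,5)]) (rule eq)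
qed

end

theory Submission
  imports Defs
begin

text \<open>
  Each operator \<open>f \<mapsto> f\<^sup>(\<^sup>k\<^sup>)\<close> is linear and continuous for uniform convergence on compact sets, so the sets
  of all \<open>f\<close> with \<open>\<bar>f\<^sup>(\<^sup>k\<^sup>)(z)\<bar> > n\<close> for some \<open>z \<in> \<Omega>\<close> are open. Their intersection over \<open>k\<close> and \<open>n\<close> is
  the set in question, and by a Baire argument it suffices that each of them is dense. For this, some
  single \<open>g\<close> with \<open>g\<^sup>(\<^sup>k\<^sup>)\<close> unbounded is enough, since small multiples of \<open>g\<close> can be added to any \<open>f\<close>.
  If \<open>k \<ge> 0\<close>, integrate an unbounded function \<open>k\<close> times. If \<open>k = -n\<close>, differentiate an unbounded
  function with a zero of order \<open>n\<close> at \<open>\<zeta>0\<close>: integrating \<open>n\<close> times from \<open>\<zeta>0\<close> then gives it back.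
  Such a function is \<open>(z - \<zeta>0)\<^sup>n * (z - \<zeta>0)\<close> if \<open>\<Omega>\<close> is unbounded, and \<open>(z - \<zeta>0)\<^sup>n / (z - a)\<close> with a
  boundary point \<open>a\<close> otherwise.
\<close>

section \<open>The Baire property of \<open>Hol \<Omega>\<close>\<close>

text \<open>The classical nested-ball argument, run on compact sets and radii instead of a metric:
  closed neighbourhoods shrink through the dense open sets, their centres converge locally
  uniformly, and the limit is holomorphic and lies in all of them. The factor
  \<open>Hol \<Omega>\<close> makes the empty family give the whole space instead of
  \<open>UNIV\<close>.\<close>

lemma Hol_Baire:
  assumes "open \<Omega>" and "countable \<G>"
    and G: "\<And>U. U \<in> \<G> \<Longrightarrow> openin (Hol_topology \<Omega>) U \<and>
              Hol_topology \<Omega> closure_of U = topspace (Hol_topology \<Omega>)"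
  shows "Hol_topology \<Omega> closure_of (Hol \<Omega> \<inter> \<Inter>\<G>) = topspace (Hol_topology \<Omega>)"
proof (cases "\<G> = {}")
  case True
  then show ?thesis
    by (metis Inf_empty closure_of_topspace inf_top.right_neutral topspace_Hol_topology)
next
  case False
  define U where "U = from_nat_into \<G>"
  have U_range: "range U = \<G>"
    unfolding U_def using range_from_nat_into[OF False \<open>countable \<G>\<close>] .
  have U_open: "openin (Hol_topology \<Omega>) (U n)" for n
    using G U_range by blast
  have U_dense: "U n \<inter> T \<noteq> {}" if "openin (Hol_topology \<Omega>) T" "T \<noteq> {}" for n T
    using G[of "U n"] U_range that dense_intersects_open by blast
  obtain C :: "nat \<Rightarrow> complex set" where C: "\<And>n. compact (C n)" "\<And>n. C n \<subseteq> \<Omega>"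
    and C_exhausts: "\<And>K. \<lbrakk>compact K; K \<subseteq> \<Omega>\<rbrakk> \<Longrightarrow> \<exists>N. \<forall>n\<ge>N. K \<subseteq> C n"
  proof (rule open_Union_compact_subsets[OF \<open>open \<Omega>\<close>])
    fix C :: "nat \<Rightarrow> complex set"
    assume "\<And>n. compact (C n)" "\<And>n. C n \<subseteq> \<Omega>"
      "\<And>K. \<lbrakk>compact K; K \<subseteq> \<Omega>\<rbrakk> \<Longrightarrow> \<exists>N. \<forall>n\<ge>N. K \<subseteq> C n"
    then show thesis by (rule that[of C])
  qed
  \<comment> \<open>The non-strict counterpart of \<open>basic_nbhd\<close>: it is closed under
    pointwise limits within \<open>Hol \<Omega>\<close>, which keeps the final limit inside every
    stage.\<close>
  define CB where "CB f K e = {g \<in> Hol \<Omega>. \<forall>z\<in>K. dist (f z) (g z) \<le> e}" for f K and e :: real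
  show ?thesis
    unfolding dense_intersects_open
  proof (intro allI impI)
    fix T assume T: "openin (Hol_topology \<Omega>) T \<and> T \<noteq> {}"
    \<comment> \<open>State of the construction: containing \<open>C n\<close> makes the sets
      \<open>K\<close> eventually cover every compact subset of \<open>\<Omega>\<close>, and the
      radius bound \<open>(1/2) ^ n\<close> forces the Cauchy property.\<close>
    define P where "P n p \<longleftrightarrow> (case p of (f, K, e) \<Rightarrow>
        f \<in> Hol \<Omega> \<and> compact K \<and> K \<subseteq> \<Omega> \<and> C n \<subseteq> K \<and> 0 < e \<and> e \<le> (1/2) ^ n \<and> CB f K e \<subseteq> T)"
      for n :: nat and p :: "(complex \<Rightarrow> complex) \<times> complex set \<times> real"
    \<comment> \<open>The index is shifted: the passage from stage \<open>n\<close> to stage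
      \<open>Suc n\<close> is what enters \<open>U n\<close>, so stage 0 only has to lie in
      \<open>T\<close>.\<close>
    define Q where "Q n p q \<longleftrightarrow> (case p of (f, K, e) \<Rightarrow> case q of (g, L, d) \<Rightarrow>
        CB g L d \<subseteq> U n \<inter> CB f K e)"
      for n and p q :: "(complex \<Rightarrow> complex) \<times> complex set \<times> real"
    have shrink: "\<exists>p. P n p \<and> (case p of (g, L, d) \<Rightarrow> CB g L d \<subseteq> W)"
      if W: "openin (Hol_topology \<Omega>) W" "g \<in> W" "W \<subseteq> T" for W g n
    proof -
      obtain L d where L: "compact L" "L \<subseteq> \<Omega>" "d > 0" "basic_nbhd \<Omega> g L d \<subseteq> W"
        using W unfolding openin_Hol_topology by blast
      have "g \<in> Hol \<Omega>"
        using W openin_subset by fastforce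
      \<comment> \<open>Halving \<open>d\<close> turns the non-strict bound of \<open>CB\<close>
        into the strict one of \<open>basic_nbhd\<close>; enlarging \<open>L\<close> by
        \<open>C n\<close> only shrinks the set.\<close>
      have "CB g (L \<union> C n) (min (d/2) ((1/2)^n)) \<subseteq> basic_nbhd \<Omega> g L d"
      proof
        fix h assume "h \<in> CB g (L \<union> C n) (min (d/2) ((1/2)^n))"
        then have h: "h \<in> Hol \<Omega>" "\<And>z. z \<in> L \<Longrightarrow> dist (g z) (h z) \<le> d/2"
          by (auto simp: CB_def)
        have "dist (g z) (h z) < d" if "z \<in> L" for z
          using h(2)[OF that] L(3) by linarith
        then show "h \<in> basic_nbhd \<Omega> g L d"
          using h(1) by (auto simp: basic_nbhd_def)
      qed
      then have "CB g (L \<union> C n) (min (d/2) ((1/2)^n)) \<subseteq> W"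
        using L(4) by blast
      then show ?thesis
        using L(1-3) C \<open>g \<in> Hol \<Omega>\<close> W(3)
        by (intro exI[of _ "(g, L \<union> C n, min (d/2) ((1/2)^n))"]) (auto simp: P_def)
    qed
    have start: "\<exists>p. P 0 p"
      using T shrink[of T] by blast
    have step: "\<exists>q. P (Suc n) q \<and> Q n p q" if "P n p" for n p
    proof -
      obtain f K e where p: "p = (f, K, e)" by (cases p) auto
      have f: "f \<in> Hol \<Omega>" "compact K" "K \<subseteq> \<Omega>" "0 < e" "CB f K e \<subseteq> T"
        using that by (auto simp: P_def p)
      have nb: "openin (Hol_topology \<Omega>) (basic_nbhd \<Omega> f K e)"
        by (rule openin_basic_nbhd) (use f in auto)
      have "f \<in> basic_nbhd \<Omega> f K e"
        using f by (auto simp: basic_nbhd_def)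
      then obtain g where g: "g \<in> U n \<inter> basic_nbhd \<Omega> f K e"
        using U_dense[OF nb, of n] by blast
      have sub: "basic_nbhd \<Omega> f K e \<subseteq> CB f K e"
        by (fastforce simp: basic_nbhd_def CB_def)
      then obtain q where "P (Suc n) q" "case q of (g, L, d) \<Rightarrow> CB g L d \<subseteq> U n \<inter> basic_nbhd \<Omega> f K e"
        using shrink[of "U n \<inter> basic_nbhd \<Omega> f K e" g "Suc n"] g f(5) openin_Int[OF U_open nb] by blast
      then show ?thesis
        using sub by (intro exI[of _ q]) (auto simp: Q_def p split: prod.splits)
    qed
    obtain s where s: "\<And>n. P n (s n)" "\<And>n. Q n (s n) (s (Suc n))"
      using dependent_nat_choice[of P Q, OF start step] by blast
    define F where "F n = fst (s n)" for n
    define K where "K n = fst (snd (s n))" for n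
    define e where "e n = snd (snd (s n))" for n
    have s_eq: "s n = (F n, K n, e n)" for n
      by (simp add: F_def K_def e_def)
    have F: "F n \<in> Hol \<Omega>" "C n \<subseteq> K n" "K n \<subseteq> \<Omega>" "0 < e n" "e n \<le> (1/2)^n" "CB (F n) (K n) (e n) \<subseteq> T" for n
      using s(1)[of n] by (auto simp: P_def s_eq)
    define B where "B n = CB (F n) (K n) (e n)" for n
    have B_Suc: "B (Suc n) \<subseteq> U n \<inter> B n" for n
      using s(2)[of n] by (auto simp: Q_def s_eq B_def)
    have B_mono: "B m \<subseteq> B n" if "n \<le> m" for m n
      by (rule lift_Suc_antimono_le[OF _ that]) (use B_Suc in blast)
    have F_in: "F m \<in> B n" if "n \<le> m" for m n
    proof -
      have "F m \<in> B m" using F[of m] by (auto simp: B_def CB_def)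
      then show ?thesis using B_mono[OF that] by blast
    qed
    have close: "dist (F n z) (F m z) \<le> e n" if "n \<le> m" "z \<in> K n" for n m z
      using F_in[OF that(1)] that(2) by (auto simp: B_def CB_def)
    \<comment> \<open>From some stage on, \<open>L\<close> lies in \<open>C m\<close> and hence in
      \<open>K m\<close>, where all later centres differ from \<open>F m\<close> by at most
      \<open>e m\<close>.\<close>
    have Cauchy_C: "uniformly_Cauchy_on L F" if L: "compact L" "L \<subseteq> \<Omega>" for L
    proof (rule uniformly_Cauchy_onI')
      fix \<epsilon> :: real assume "\<epsilon> > 0"
      obtain N where N: "\<And>n. n \<ge> N \<Longrightarrow> L \<subseteq> C n" using C_exhausts[OF L] by blast
      obtain M where M: "(1/2)^M < \<epsilon>" using real_arch_pow_inv[OF \<open>\<epsilon> > 0\<close>, of "1/2"] by auto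
      have "dist (F m x) (F n x) < \<epsilon>" if "x \<in> L" "m \<ge> max N M" "n > m" for x m n
      proof -
        have "x \<in> K m" using that N[of m] F(2)[of m] by auto
        then have "dist (F m x) (F n x) \<le> e m" using close that by simp
        also have "\<dots> \<le> (1/2)^m" by (rule F)
        also have "\<dots> \<le> (1/2)^M" using that by (intro power_decreasing) auto
        finally show ?thesis using M by simp
      qed
      then show "\<exists>M. \<forall>x\<in>L. \<forall>m\<ge>M. \<forall>n>m. dist (F m x) (F n x) < \<epsilon>" by blast
    qed
    \<comment> \<open>The pointwise limit, made extensional as \<open>Hol\<close> requires; it
      agrees on \<open>\<Omega>\<close> with each of the uniform limits over compact sets.\<close>
    define g where "g = restrict (\<lambda>z. lim (\<lambda>n. F n z)) \<Omega>"
    have ulim: "uniform_limit L F g sequentially" if L: "compact L" "L \<subseteq> \<Omega>" for L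
    proof -
      obtain l where l: "uniform_limit L F l sequentially"
        using Cauchy_C[OF L] uniformly_convergent_eq_Cauchy uniformly_convergent_on_def by metis
      have "l z = g z" if "z \<in> L" for z
        using tendsto_uniform_limitI[OF l that] L that by (auto simp: g_def limI)
      then show ?thesis
        using l uniform_limit_cong'[of L F F l g sequentially] by simp
    qed
    have "g holomorphic_on \<Omega>"
    proof (rule holomorphic_uniform_sequence[OF \<open>open \<Omega>\<close>])
      show "F n holomorphic_on \<Omega>" for n using F(1) by (auto simp: Hol_def)
      fix x assume "x \<in> \<Omega>"
      then obtain d where "0 < d" "cball x d \<subseteq> \<Omega>"
        using \<open>open \<Omega>\<close> open_contains_cball by blast
      then show "\<exists>d. 0 < d \<and> cball x d \<subseteq> \<Omega> \<and> uniform_limit (cball x d) F g sequentially"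
        using ulim[of "cball x d"] by auto
    qed
    then have g: "g \<in> Hol \<Omega>"
      by (auto simp: Hol_def g_def)
    have gB: "g \<in> B n" for n
    proof -
      have "dist (F n z) (g z) \<le> e n" if "z \<in> K n" for z
      proof -
        have "z \<in> \<Omega>" using that F(3) by blast
        then have "(\<lambda>m. F m z) \<longlonglongrightarrow> g z"
          using tendsto_uniform_limitI[OF ulim[of "{z}"]] by auto
        then have "(\<lambda>m. dist (F n z) (F m z)) \<longlonglongrightarrow> dist (F n z) (g z)"
          by (intro tendsto_intros)
        then show ?thesis
          using close that by (intro LIMSEQ_le_const2) blast+
      qed
      then show ?thesis using g by (auto simp: B_def CB_def)
    qed
    have "g \<in> T" using gB[of 0] F(6)[of 0] by (auto simp: B_def)
    moreover have "g \<in> \<Inter>\<G>"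
      using gB B_Suc U_range by blast
    ultimately show "Hol \<Omega> \<inter> \<Inter>\<G> \<inter> T \<noteq> {}"
      using g by blast
  qed
qed

section \<open>Linear operators with compact-to-compact bounds\<close>

text \<open>Taking \<open>c = 0\<close> in the linearity clause shows that \<open>A f\<close> depends, on \<open>\<Omega>\<close>, only on the values
  of \<open>f\<close> on \<open>\<Omega>\<close>.\<close>

definition hol_linear :: "complex set \<Rightarrow> ((complex \<Rightarrow> complex) \<Rightarrow> complex \<Rightarrow> complex) \<Rightarrow> bool" where
  "hol_linear \<Omega> A \<longleftrightarrow>
     (\<forall>f. f holomorphic_on \<Omega> \<longrightarrow> A f holomorphic_on \<Omega>) \<and>
     (\<forall>f g h c. f holomorphic_on \<Omega> \<and> g holomorphic_on \<Omega> \<and> h holomorphic_on \<Omega> \<and>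
        (\<forall>z\<in>\<Omega>. h z = f z + c * g z) \<longrightarrow> (\<forall>z\<in>\<Omega>. A h z = A f z + c * A g z)) \<and>
     (\<forall>K. compact K \<and> K \<subseteq> \<Omega> \<longrightarrow> (\<exists>L M. compact L \<and> L \<subseteq> \<Omega> \<and> 0 \<le> M \<and>
        (\<forall>f B. f holomorphic_on \<Omega> \<and> 0 \<le> B \<and> (\<forall>w\<in>L. norm (f w) \<le> B) \<longrightarrow>
           (\<forall>z\<in>K. norm (A f z) \<le> M * B))))"

lemma hol_linear_holomorphic: "hol_linear \<Omega> A \<Longrightarrow> f holomorphic_on \<Omega> \<Longrightarrow> A f holomorphic_on \<Omega>"
  by (simp add: hol_linear_def)

lemma hol_linear_add:
  assumes "hol_linear \<Omega> A" "f holomorphic_on \<Omega>" "g holomorphic_on \<Omega>" "h holomorphic_on \<Omega>"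
    "\<And>z. z \<in> \<Omega> \<Longrightarrow> h z = f z + c * g z" "z \<in> \<Omega>"
  shows "A h z = A f z + c * A g z"
proof -
  have "\<forall>f g h c. f holomorphic_on \<Omega> \<and> g holomorphic_on \<Omega> \<and> h holomorphic_on \<Omega> \<and>
        (\<forall>z\<in>\<Omega>. h z = f z + c * g z) \<longrightarrow> (\<forall>z\<in>\<Omega>. A h z = A f z + c * A g z)"
    using assms(1) by (simp add: hol_linear_def)
  then show ?thesis
    using assms(2-) by auto
qed

lemma hol_linear_cong:
  assumes "hol_linear \<Omega> A" "f holomorphic_on \<Omega>" "h holomorphic_on \<Omega>"
    "\<And>z. z \<in> \<Omega> \<Longrightarrow> h z = f z" "z \<in> \<Omega>"
  shows "A h z = A f z"
  using hol_linear_add[OF assms(1,2,2,3), of 0] assms by simp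

lemma hol_linear_bound:
  assumes "hol_linear \<Omega> A" "compact K" "K \<subseteq> \<Omega>"
  obtains L M where "compact L" "L \<subseteq> \<Omega>" "0 \<le> M"
    "\<And>f B z. \<lbrakk>f holomorphic_on \<Omega>; 0 \<le> B; \<And>w. w \<in> L \<Longrightarrow> norm (f w) \<le> B; z \<in> K\<rbrakk>
       \<Longrightarrow> norm (A f z) \<le> M * B"
proof -
  obtain L M where "compact L \<and> L \<subseteq> \<Omega> \<and> 0 \<le> M \<and>
        (\<forall>f B. f holomorphic_on \<Omega> \<and> 0 \<le> B \<and> (\<forall>w\<in>L. norm (f w) \<le> B) \<longrightarrow>
           (\<forall>z\<in>K. norm (A f z) \<le> M * B))"
    using assms(1)[unfolded hol_linear_def, THEN conjunct2, THEN conjunct2, rule_format, OF conjI[OF assms(2,3)]]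
    by blast
  then show ?thesis by (intro that[of L M]) auto
qed

text \<open>The estimate need only be checked near each point: finitely many of the balls cover a
  compact \<open>K\<close>, and the union of their sets \<open>L x\<close> and the sum of their
  constants \<open>M x\<close> serve for all of \<open>K\<close>.\<close>

lemma hol_linearI:
  assumes hol: "\<And>f. f holomorphic_on \<Omega> \<Longrightarrow> A f holomorphic_on \<Omega>"
    and add: "\<And>f g h c z. \<lbrakk>f holomorphic_on \<Omega>; g holomorphic_on \<Omega>; h holomorphic_on \<Omega>;
        \<And>z. z \<in> \<Omega> \<Longrightarrow> h z = f z + c * g z; z \<in> \<Omega>\<rbrakk> \<Longrightarrow> A h z = A f z + c * A g z"
    and bound: "\<And>x. x \<in> \<Omega> \<Longrightarrow> \<exists>r L M. 0 < r \<and> compact L \<and> L \<subseteq> \<Omega> \<and> 0 \<le> M \<and>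
        (\<forall>f B. f holomorphic_on \<Omega> \<and> 0 \<le> B \<and> (\<forall>w\<in>L. norm (f w) \<le> B) \<longrightarrow>
           (\<forall>z\<in>ball x r. norm (A f z) \<le> M * B))"
  shows "hol_linear \<Omega> A"
  unfolding hol_linear_def
proof (intro conjI allI impI)
  show "A f holomorphic_on \<Omega>" if "f holomorphic_on \<Omega>" for f
    by (rule hol[OF that])
  show "\<forall>z\<in>\<Omega>. A h z = A f z + c * A g z"
    if "f holomorphic_on \<Omega> \<and> g holomorphic_on \<Omega> \<and> h holomorphic_on \<Omega> \<and>
        (\<forall>z\<in>\<Omega>. h z = f z + c * g z)" for f g h c
    using add[of f g h c] that by blast
  fix K assume K: "compact K \<and> K \<subseteq> \<Omega>"
  obtain r L M where rLM: "\<And>x. x \<in> \<Omega> \<Longrightarrow> 0 < r x \<and> compact (L x) \<and> L x \<subseteq> \<Omega> \<and> 0 \<le> M x \<and>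
        (\<forall>f B. f holomorphic_on \<Omega> \<and> 0 \<le> B \<and> (\<forall>w\<in>L x. norm (f w) \<le> B) \<longrightarrow>
           (\<forall>z\<in>ball x (r x). norm (A f z) \<le> M x * B))"
    using bound by metis
  have "K \<subseteq> (\<Union>x\<in>K. ball x (r x))"
  proof
    fix x assume "x \<in> K"
    then have "0 < r x" using K rLM[of x] by blast
    then show "x \<in> (\<Union>x\<in>K. ball x (r x))" using \<open>x \<in> K\<close> by (intro UN_I[of x]) auto
  qed
  then obtain D where D: "D \<subseteq> K" "finite D" "K \<subseteq> (\<Union>x\<in>D. ball x (r x))"
    using compactE_image[of K K "\<lambda>x. ball x (r x)"] K by auto
  have D\<Omega>: "x \<in> \<Omega>" if "x \<in> D" for x
    using D K that by blast
  show "\<exists>L M. compact L \<and> L \<subseteq> \<Omega> \<and> 0 \<le> M \<and>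
        (\<forall>f B. f holomorphic_on \<Omega> \<and> 0 \<le> B \<and> (\<forall>w\<in>L. norm (f w) \<le> B) \<longrightarrow>
           (\<forall>z\<in>K. norm (A f z) \<le> M * B))"
  proof (intro exI[of _ "\<Union>x\<in>D. L x"] exI[of _ "\<Sum>x\<in>D. M x"] conjI allI impI ballI)
    show "compact (\<Union>x\<in>D. L x)"
      using D(2) rLM D\<Omega> by (intro compact_UN) blast+
    show "(\<Union>x\<in>D. L x) \<subseteq> \<Omega>"
      using rLM D\<Omega> by blast
    show "0 \<le> (\<Sum>x\<in>D. M x)"
      using rLM D\<Omega> by (intro sum_nonneg) blast
    fix f B z
    assume f: "f holomorphic_on \<Omega> \<and> 0 \<le> B \<and> (\<forall>w\<in>\<Union>x\<in>D. L x. norm (f w) \<le> B)" and "z \<in> K"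
    then obtain x where x: "x \<in> D" "z \<in> ball x (r x)"
      using D(3) by blast
    then have "norm (A f z) \<le> M x * B"
      using rLM[OF D\<Omega>[OF x(1)]] f by blast
    also have "M x \<le> (\<Sum>x\<in>D. M x)"
      using x(1) D(2) rLM D\<Omega> by (intro member_le_sum) auto
    finally show "norm (A f z) \<le> (\<Sum>x\<in>D. M x) * B"
      using f by (simp add: mult_right_mono)
  qed
qed

lemma hol_linear_id: "hol_linear \<Omega> (\<lambda>f. f)"
  unfolding hol_linear_def
proof (intro conjI allI impI)
  fix K assume "compact K \<and> K \<subseteq> \<Omega>"
  then show "\<exists>L M. compact L \<and> L \<subseteq> \<Omega> \<and> 0 \<le> M \<and>
        (\<forall>f B. f holomorphic_on \<Omega> \<and> 0 \<le> B \<and> (\<forall>w\<in>L. norm (f w) \<le> B) \<longrightarrow>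
           (\<forall>z\<in>K. norm (f z) \<le> M * B))"
    by (intro exI[of _ K] exI[of _ 1]) auto
qed auto

text \<open>The estimates chain: the compact set on which the outer operator needs control of its
  argument is the one on which the inner operator is then estimated, and the constants
  multiply.\<close>

lemma hol_linear_compose:
  assumes A: "hol_linear \<Omega> A" and A': "hol_linear \<Omega> A'"
  shows "hol_linear \<Omega> (\<lambda>f. A (A' f))"
  unfolding hol_linear_def
proof (intro conjI allI impI ballI)
  show "A (A' f) holomorphic_on \<Omega>" if "f holomorphic_on \<Omega>" for f
    using that A A' hol_linear_holomorphic by blast
  fix f g h c z
  assume *: "f holomorphic_on \<Omega> \<and> g holomorphic_on \<Omega> \<and> h holomorphic_on \<Omega> \<and>
        (\<forall>z\<in>\<Omega>. h z = f z + c * g z)" and "z \<in> \<Omega>"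
  show "A (A' h) z = A (A' f) z + c * A (A' g) z"
  proof (rule hol_linear_add[OF A _ _ _ _ \<open>z \<in> \<Omega>\<close>])
    show "A' h w = A' f w + c * A' g w" if "w \<in> \<Omega>" for w
      using hol_linear_add[OF A', of f g h c] * that by blast
  qed (use * hol_linear_holomorphic[OF A'] in blast)+
next
  fix K assume K: "compact K \<and> K \<subseteq> \<Omega>"
  obtain L M where L: "compact L" "L \<subseteq> \<Omega>" "0 \<le> M"
    "\<And>f B z. \<lbrakk>f holomorphic_on \<Omega>; 0 \<le> B; \<And>w. w \<in> L \<Longrightarrow> norm (f w) \<le> B; z \<in> K\<rbrakk>
       \<Longrightarrow> norm (A f z) \<le> M * B"
    using hol_linear_bound[OF A] K by metis
  obtain L' M' where L': "compact L'" "L' \<subseteq> \<Omega>" "0 \<le> M'"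
    "\<And>f B z. \<lbrakk>f holomorphic_on \<Omega>; 0 \<le> B; \<And>w. w \<in> L' \<Longrightarrow> norm (f w) \<le> B; z \<in> L\<rbrakk>
       \<Longrightarrow> norm (A' f z) \<le> M' * B"
    using hol_linear_bound[OF A' L(1,2)] by metis
  have "norm (A (A' f) z) \<le> M * M' * B"
    if f: "f holomorphic_on \<Omega>" "0 \<le> B" "\<forall>w\<in>L'. norm (f w) \<le> B" and "z \<in> K" for f B z
  proof -
    have "norm (A (A' f) z) \<le> M * (M' * B)"
    proof (rule L(4)[OF _ _ _ \<open>z \<in> K\<close>])
      show "A' f holomorphic_on \<Omega>" using f A' hol_linear_holomorphic by blast
      show "0 \<le> M' * B" using f L' by simp
      show "norm (A' f w) \<le> M' * B" if "w \<in> L" for w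
        using L'(4)[OF f(1,2)] f(3) that by blast
    qed
    then show ?thesis by (simp add: mult.assoc)
  qed
  then show "\<exists>L M. compact L \<and> L \<subseteq> \<Omega> \<and> 0 \<le> M \<and>
        (\<forall>f B. f holomorphic_on \<Omega> \<and> 0 \<le> B \<and> (\<forall>w\<in>L. norm (f w) \<le> B) \<longrightarrow>
           (\<forall>z\<in>K. norm (A (A' f) z) \<le> M * B))"
    using L(3) L' by (intro exI[of _ L'] exI[of _ "M * M'"]) auto
qed

lemma hol_linear_funpow:
  assumes "hol_linear \<Omega> A"
  shows "hol_linear \<Omega> (A ^^ n)"
proof (induction n)
  case 0
  show ?case using hol_linear_id by (simp add: id_def)
next
  case (Suc n)
  have "A ^^ Suc n = (\<lambda>f. A ((A ^^ n) f))" by auto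
  then show ?case using hol_linear_compose[OF assms Suc] by simp
qed

section \<open>Differentiation and integration as such operators\<close>

text \<open>The estimate is Cauchy's: a point of \<open>ball x (r/2)\<close> is the centre of a disc
  of radius \<open>r/2\<close> inside \<open>cball x r\<close>, which gives the constant
  \<open>2/r\<close>.\<close>

lemma hol_linear_deriv:
  assumes "open \<Omega>"
  shows "hol_linear \<Omega> deriv"
proof (rule hol_linearI)
  show "deriv f holomorphic_on \<Omega>" if "f holomorphic_on \<Omega>" for f
    using that assms by (rule holomorphic_deriv)
  show "deriv h z = deriv f z + c * deriv g z"
    if "f holomorphic_on \<Omega>" "g holomorphic_on \<Omega>" "h holomorphic_on \<Omega>"
      "\<And>z. z \<in> \<Omega> \<Longrightarrow> h z = f z + c * g z" "z \<in> \<Omega>" for f g h c z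
  proof -
    have "((\<lambda>z. f z + c * g z) has_field_derivative deriv f z + c * deriv g z) (at z)"
      using holomorphic_derivI[OF that(1) assms that(5)] holomorphic_derivI[OF that(2) assms that(5)]
      by (auto intro!: derivative_eq_intros)
    then have "(h has_field_derivative deriv f z + c * deriv g z) (at z)"
      by (rule has_field_derivative_transform_within_open[OF _ assms that(5)]) (use that(4) in auto)
    then show ?thesis by (rule DERIV_imp_deriv)
  qed
  fix x assume "x \<in> \<Omega>"
  then obtain r where r: "0 < r" "cball x r \<subseteq> \<Omega>"
    using assms open_contains_cball by blast
  have "norm (deriv f z) \<le> (2 / r) * B"
    if f: "f holomorphic_on \<Omega>" "\<forall>w\<in>cball x r. norm (f w) \<le> B" and z: "z \<in> ball x (r/2)" for f B z
  proof -
    have sub: "cball z (r/2) \<subseteq> cball x r"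
      using z by (simp add: subset_cball cball_subset_cball_iff dist_commute)
    have "norm ((deriv ^^ 1) f z) \<le> fact 1 * B / (r/2) ^ 1"
    proof (rule Cauchy_inequality)
      have hol: "f holomorphic_on cball z (r/2)"
        using f(1) sub r(2) by (meson holomorphic_on_subset)
      then show "f holomorphic_on ball z (r/2)"
        using ball_subset_cball holomorphic_on_subset by blast
      show "continuous_on (cball z (r/2)) f"
        by (rule holomorphic_on_imp_continuous_on[OF hol])
      show "norm (f w) \<le> B" if "norm (z - w) = r/2" for w
        using f(2) sub that by (auto simp: dist_norm)
    qed (use r in auto)
    then show ?thesis by (simp add: field_simps)
  qed
  then show "\<exists>r L M. 0 < r \<and> compact L \<and> L \<subseteq> \<Omega> \<and> 0 \<le> M \<and>
        (\<forall>f B. f holomorphic_on \<Omega> \<and> 0 \<le> B \<and> (\<forall>w\<in>L. norm (f w) \<le> B) \<longrightarrow>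
           (\<forall>z\<in>ball x r. norm (deriv f z) \<le> M * B))"
    using r by (intro exI[of _ "r/2"] exI[of _ "cball x r"] exI[of _ "2/r"]) auto
qed

lemma T_op_of_primitive:
  assumes "open \<Omega>" "connected \<Omega>" "\<zeta>0 \<in> \<Omega>" "z \<in> \<Omega>"
    and "\<And>x. x \<in> \<Omega> \<Longrightarrow> (h has_field_derivative f x) (at x)"
  shows "T_op \<Omega> \<zeta>0 f z = h z - h \<zeta>0"
proof -
  obtain g where "polygonal_from_to \<Omega> \<zeta>0 z g"
    using polygonal_from_to_exists[OF assms(1-4)] by blast
  then show ?thesis using T_op_primitive[OF assms(5)] by blast
qed

text \<open>\<open>T_op \<Omega> \<zeta>0 f\<close> has derivative \<open>f\<close>, so this is the
  mean value inequality on the convex set \<open>cball x r\<close>.\<close>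

lemma T_op_local_bound:
  assumes "open \<Omega>" "simply_connected \<Omega>" "\<zeta>0 \<in> \<Omega>" "f holomorphic_on \<Omega>"
    and "cball x r \<subseteq> \<Omega>" "0 \<le> B" "\<And>w. w \<in> cball x r \<Longrightarrow> norm (f w) \<le> B" "z \<in> cball x r"
  shows "norm (T_op \<Omega> \<zeta>0 f x - T_op \<Omega> \<zeta>0 f z) \<le> r * B"
proof -
  have "norm (T_op \<Omega> \<zeta>0 f x - T_op \<Omega> \<zeta>0 f z) \<le> B * norm (x - z)"
  proof (rule field_differentiable_bound[where S = "cball x r" and f' = f])
    show "(T_op \<Omega> \<zeta>0 f has_field_derivative f w) (at w within cball x r)" if "w \<in> cball x r" for w
      using T_op_has_field_derivative[OF assms(1-4)] that assms(5)
      by (meson has_field_derivative_at_within subsetD)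
    show "x \<in> cball x r" using assms(8) by (metis centre_in_cball mem_cball order_trans zero_le_dist)
  qed (use assms in auto)
  also have "\<dots> \<le> B * r"
    using assms(6,8) by (intro mult_left_mono) (auto simp: dist_norm)
  finally show ?thesis by (simp add: mult.commute)
qed

text \<open>The value at \<open>\<zeta>0\<close> is 0, and on small discs values change by a
  controlled amount. Connectedness propagates this control from \<open>\<zeta>0\<close> to any
  point, so no length of a polygonal line has to be estimated.\<close>

lemma hol_linear_T_op:
  assumes "open \<Omega>" "simply_connected \<Omega>" "\<zeta>0 \<in> \<Omega>"
  shows "hol_linear \<Omega> (T_op \<Omega> \<zeta>0)"
proof (rule hol_linearI)
  note der = T_op_has_field_derivative[OF assms]
  have con: "connected \<Omega>" using assms(2) by (rule simply_connected_imp_connected)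
  note T_prim = T_op_of_primitive[OF assms(1) con assms(3)]
  \<comment> \<open>\<open>T_op \<Omega> \<zeta>0 f\<close> serves as its own primitive here, so the
    value at \<open>\<zeta>0\<close> becomes a difference of equal terms.\<close>
  have T0: "T_op \<Omega> \<zeta>0 f \<zeta>0 = 0" if "f holomorphic_on \<Omega>" for f
    using T_prim[OF assms(3) der[OF that]] by simp
  show "T_op \<Omega> \<zeta>0 f holomorphic_on \<Omega>" if "f holomorphic_on \<Omega>" for f
    using der[OF that] assms(1) by (auto simp: holomorphic_on_open)
  show "T_op \<Omega> \<zeta>0 h z = T_op \<Omega> \<zeta>0 f z + c * T_op \<Omega> \<zeta>0 g z"
    if "f holomorphic_on \<Omega>" "g holomorphic_on \<Omega>" "h holomorphic_on \<Omega>"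
      "\<And>z. z \<in> \<Omega> \<Longrightarrow> h z = f z + c * g z" "z \<in> \<Omega>" for f g h c z
  proof -
    \<comment> \<open>The combination of the two integrals is a primitive of \<open>h\<close> on
      \<open>\<Omega>\<close>; by \<open>T0\<close> the subtracted value at \<open>\<zeta>0\<close>
      vanishes.\<close>
    have "T_op \<Omega> \<zeta>0 h z = (T_op \<Omega> \<zeta>0 f z + c * T_op \<Omega> \<zeta>0 g z) - (T_op \<Omega> \<zeta>0 f \<zeta>0 + c * T_op \<Omega> \<zeta>0 g \<zeta>0)"
      by (rule T_prim[where h = "\<lambda>z. T_op \<Omega> \<zeta>0 f z + c * T_op \<Omega> \<zeta>0 g z"])
         (use that der[OF that(1)] der[OF that(2)] in \<open>auto intro!: derivative_eq_intros\<close>)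
    then show ?thesis using T0 that by simp
  qed
  \<comment> \<open>\<open>R x y\<close> says that the integral from \<open>x\<close> to
    \<open>y\<close> is controlled by the size of \<open>f\<close> on one compact set, uniformly in
    \<open>f\<close>. This is an equivalence relation whose classes are open in
    \<open>\<Omega>\<close>.\<close>
  define R where "R x y \<longleftrightarrow> (\<exists>L M. compact L \<and> L \<subseteq> \<Omega> \<and> 0 \<le> M \<and>
      (\<forall>f B. f holomorphic_on \<Omega> \<and> 0 \<le> B \<and> (\<forall>w\<in>L. norm (f w) \<le> B) \<longrightarrow>
         norm (T_op \<Omega> \<zeta>0 f x - T_op \<Omega> \<zeta>0 f y) \<le> M * B))" for x y
  have R: "R \<zeta>0 x" if "x \<in> \<Omega>" for x
  proof (rule connected_equivalence_relation[OF con assms(3) that])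
    show "R y x" if "R x y" for x y
      using that by (simp add: R_def norm_minus_commute)
    show "R x z" if xy: "R x y" and yz: "R y z" for x y z
    proof -
      obtain L M where L: "compact L" "L \<subseteq> \<Omega>" "0 \<le> M" "\<And>f B. f holomorphic_on \<Omega> \<and> 0 \<le> B \<and> (\<forall>w\<in>L. norm (f w) \<le> B) \<longrightarrow>
         norm (T_op \<Omega> \<zeta>0 f x - T_op \<Omega> \<zeta>0 f y) \<le> M * B" using xy unfolding R_def by metis
      obtain L' M' where L': "compact L'" "L' \<subseteq> \<Omega>" "0 \<le> M'" "\<And>f B. f holomorphic_on \<Omega> \<and> 0 \<le> B \<and> (\<forall>w\<in>L'. norm (f w) \<le> B) \<longrightarrow>
         norm (T_op \<Omega> \<zeta>0 f y - T_op \<Omega> \<zeta>0 f z) \<le> M' * B" using yz unfolding R_def by metis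
      have "norm (T_op \<Omega> \<zeta>0 f x - T_op \<Omega> \<zeta>0 f z) \<le> (M + M') * B"
        if "f holomorphic_on \<Omega> \<and> 0 \<le> B \<and> (\<forall>w\<in>L \<union> L'. norm (f w) \<le> B)" for f B
      proof -
        have "norm (T_op \<Omega> \<zeta>0 f x - T_op \<Omega> \<zeta>0 f z) \<le>
            norm (T_op \<Omega> \<zeta>0 f x - T_op \<Omega> \<zeta>0 f y) + norm (T_op \<Omega> \<zeta>0 f y - T_op \<Omega> \<zeta>0 f z)"
          by (metis dist_norm dist_triangle)
        also have "\<dots> \<le> M * B + M' * B"
          using L(4)[of f B] L'(4)[of f B] that by (intro add_mono) blast+
        finally show ?thesis by (simp add: distrib_right)
      qed
      then show ?thesis
        unfolding R_def using L L' by (intro exI[of _ "L \<union> L'"] exI[of _ "M + M'"]) auto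
    qed
    fix a assume "a \<in> \<Omega>"
    then obtain r where r: "0 < r" "cball a r \<subseteq> \<Omega>"
      using assms(1) open_contains_cball by blast
    have "R a x" if "x \<in> ball a r" for x
      unfolding R_def
      by (intro exI[of _ "cball a r"] exI[of _ r] conjI allI impI)
         (use r that T_op_local_bound[OF assms _ r(2)] in auto)
    then show "\<exists>T. openin (top_of_set \<Omega>) T \<and> a \<in> T \<and> (\<forall>x\<in>T. R a x)"
      using r by (intro exI[of _ "ball a r"])
        (auto intro!: open_openin_trans assms(1) subset_trans[OF ball_subset_cball])
  qed
  fix x assume x: "x \<in> \<Omega>"
  then obtain r where r: "0 < r" "cball x r \<subseteq> \<Omega>"
    using assms(1) open_contains_cball by blast
  obtain L M where L: "compact L" "L \<subseteq> \<Omega>" "0 \<le> M" "\<And>f B. f holomorphic_on \<Omega> \<and> 0 \<le> B \<and> (\<forall>w\<in>L. norm (f w) \<le> B) \<longrightarrow>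
         norm (T_op \<Omega> \<zeta>0 f \<zeta>0 - T_op \<Omega> \<zeta>0 f x) \<le> M * B" using R[OF x] unfolding R_def by metis
  have "norm (T_op \<Omega> \<zeta>0 f z) \<le> (M + r) * B"
    if f: "f holomorphic_on \<Omega> \<and> 0 \<le> B \<and> (\<forall>w\<in>L \<union> cball x r. norm (f w) \<le> B)" and "z \<in> ball x r" for f B z
  proof -
    have "norm (T_op \<Omega> \<zeta>0 f z) \<le> norm (T_op \<Omega> \<zeta>0 f x) + norm (T_op \<Omega> \<zeta>0 f x - T_op \<Omega> \<zeta>0 f z)"
      by (metis norm_minus_commute norm_triangle_sub)
    also have "norm (T_op \<Omega> \<zeta>0 f x) \<le> M * B"
      using L(4)[of f B] f T0[of f] by simp
    also have "norm (T_op \<Omega> \<zeta>0 f x - T_op \<Omega> \<zeta>0 f z) \<le> r * B"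
      using T_op_local_bound[OF assms _ r(2), of f B z] that by auto
    finally show ?thesis by (simp add: distrib_right)
  qed
  then show "\<exists>r L M. 0 < r \<and> compact L \<and> L \<subseteq> \<Omega> \<and> 0 \<le> M \<and>
        (\<forall>f B. f holomorphic_on \<Omega> \<and> 0 \<le> B \<and> (\<forall>w\<in>L. norm (f w) \<le> B) \<longrightarrow>
           (\<forall>z\<in>ball x r. norm (T_op \<Omega> \<zeta>0 f z) \<le> M * B))"
    using r L by (intro exI[of _ r] exI[of _ "L \<union> cball x r"] exI[of _ "M + r"]) auto
qed

lemma hol_linear_int_deriv:
  assumes "open \<Omega>" "simply_connected \<Omega>" "\<zeta>0 \<in> \<Omega>"
  shows "hol_linear \<Omega> (int_deriv \<Omega> \<zeta>0 k)"
proof (cases "k \<ge> 0")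
  case True
  then have "int_deriv \<Omega> \<zeta>0 k = deriv ^^ nat k"
    by (intro ext) (simp add: int_deriv_def)
  then show ?thesis using hol_linear_funpow[OF hol_linear_deriv] assms by simp
next
  case False
  then have "int_deriv \<Omega> \<zeta>0 k = T_op \<Omega> \<zeta>0 ^^ nat (- k)"
    by (intro ext) (simp add: int_deriv_def)
  then show ?thesis using hol_linear_funpow[OF hol_linear_T_op] assms by simp
qed

section \<open>Openness and density\<close>

text \<open>For fixed \<open>z\<close>, the map from \<open>f\<close> to \<open>A f z\<close> is
  continuous: the compact bound at \<open>{z}\<close>, applied to \<open>f - g\<close>, shows that
  \<open>A g z\<close> stays close to \<open>A f z\<close> when \<open>g\<close> is close to
  \<open>f\<close> on \<open>L\<close>.\<close>

lemma openin_hol_linear_large: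
  assumes A: "hol_linear \<Omega> A"
  shows "openin (Hol_topology \<Omega>) {f \<in> Hol \<Omega>. \<exists>z\<in>\<Omega>. b < norm (A f z)}"
  unfolding openin_Hol_topology
proof (intro conjI ballI)
  fix f assume "f \<in> {f \<in> Hol \<Omega>. \<exists>z\<in>\<Omega>. b < norm (A f z)}"
  then obtain z where f: "f \<in> Hol \<Omega>" and z: "z \<in> \<Omega>" "b < norm (A f z)" by blast
  obtain L M where L: "compact L" "L \<subseteq> \<Omega>" "0 \<le> M"
    "\<And>f B w. \<lbrakk>f holomorphic_on \<Omega>; 0 \<le> B; \<And>w. w \<in> L \<Longrightarrow> norm (f w) \<le> B; w \<in> {z}\<rbrakk>
       \<Longrightarrow> norm (A f w) \<le> M * B"
    using hol_linear_bound[OF A, of "{z}"] z(1) by (metis bot.extremum compact_sing insert_subset)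
  \<comment> \<open>Dividing by \<open>M + 1\<close> covers \<open>M = 0\<close> and makes
    \<open>M * e\<close> strictly smaller than the gap.\<close>
  define e where "e = (norm (A f z) - b) / (M + 1)"
  have e: "e > 0" using z L(3) by (simp add: e_def)
  have Me: "M * e < norm (A f z) - b"
  proof -
    have "M * e < (M + 1) * e" using e by simp
    then show ?thesis using L(3) by (simp add: e_def)
  qed
  have "b < norm (A g z)" if g: "g \<in> basic_nbhd \<Omega> f L e" for g
  proof -
    have hol: "f holomorphic_on \<Omega>" "g holomorphic_on \<Omega>"
      using f g by (auto simp: Hol_def basic_nbhd_def)
    have "A (\<lambda>w. f w - g w) z = A f z + (-1) * A g z"
      using hol by (intro hol_linear_add[OF A _ _ _ _ z(1)]) (auto intro!: holomorphic_intros)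
    moreover have "norm (A (\<lambda>w. f w - g w) z) \<le> M * e"
      using hol e g by (intro L(4)) (auto intro!: holomorphic_intros less_imp_le simp: basic_nbhd_def dist_norm)
    ultimately have "norm (A f z - A g z) \<le> M * e" by simp
    then show ?thesis using Me norm_triangle_ineq2[of "A f z" "A g z"] by linarith
  qed
  then have "basic_nbhd \<Omega> f L e \<subseteq> {f \<in> Hol \<Omega>. \<exists>z\<in>\<Omega>. b < norm (A f z)}"
    using z(1) by (auto simp: basic_nbhd_def)
  then show "\<exists>K e. compact K \<and> K \<subseteq> \<Omega> \<and> e > 0 \<and>
      basic_nbhd \<Omega> f K e \<subseteq> {f \<in> Hol \<Omega>. \<exists>z\<in>\<Omega>. b < norm (A f z)}"
    using L(1,2) e by blast
qed blast

text \<open>If \<open>A f\<close> is bounded and \<open>A g\<close> is not, then \<open>A (f + c * g)\<close> is unbounded for every \<open>c \<noteq> 0\<close>.\<close>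

lemma dense_hol_linear_unbounded:
  assumes A: "hol_linear \<Omega> A" and g: "g holomorphic_on \<Omega>" "\<not> bounded (A g ` \<Omega>)"
  shows "Hol_topology \<Omega> closure_of {f \<in> Hol \<Omega>. \<not> bounded (A f ` \<Omega>)} = topspace (Hol_topology \<Omega>)"
  unfolding dense_intersects_open
proof (intro allI impI)
  fix T assume T: "openin (Hol_topology \<Omega>) T \<and> T \<noteq> {}"
  then obtain f where f: "f \<in> T" by blast
  obtain K e where K: "compact K" "K \<subseteq> \<Omega>" "e > 0" "basic_nbhd \<Omega> f K e \<subseteq> T"
    using T f unfolding openin_Hol_topology by blast
  have fH: "f \<in> Hol \<Omega>" using T f openin_subset by fastforce
  show "{f \<in> Hol \<Omega>. \<not> bounded (A f ` \<Omega>)} \<inter> T \<noteq> {}"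
  proof (cases "bounded (A f ` \<Omega>)")
    case False
    then show ?thesis using f fH by blast
  next
    case True
    have "bounded (g ` K)"
      using K g(1) by (intro compact_imp_bounded compact_continuous_image)
        (auto intro: holomorphic_on_imp_continuous_on holomorphic_on_subset)
    then obtain B where B: "B > 0" "\<And>z. z \<in> K \<Longrightarrow> norm (g z) \<le> B"
      by (auto simp: bounded_pos)
    \<comment> \<open>The factor 2 leaves \<open>c * g\<close> of size at most \<open>e/2\<close> on
      \<open>K\<close>, strictly inside the neighbourhood of \<open>f\<close>.\<close>
    define c where "c = complex_of_real (e / (2 * B))"
    define h where "h = restrict (\<lambda>z. f z + c * g z) \<Omega>"
    have c: "c \<noteq> 0" using K B by (simp add: c_def)
    have fhol: "f holomorphic_on \<Omega>" using fH by (simp add: Hol_def)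
    have "(\<lambda>z. f z + c * g z) holomorphic_on \<Omega>"
      using fhol g by (intro holomorphic_intros)
    then have hhol: "h holomorphic_on \<Omega>"
      by (rule holomorphic_transform) (simp add: h_def)
    then have hH: "h \<in> Hol \<Omega>" by (simp add: Hol_def h_def)
    have "dist (f z) (h z) < e" if "z \<in> K" for z
    proof -
      have "dist (f z) (h z) = norm (c * g z)"
        using that K(2) by (auto simp: h_def dist_norm)
      also have "\<dots> = (e / (2 * B)) * norm (g z)"
        using K B by (simp add: c_def norm_mult norm_divide)
      also have "\<dots> \<le> (e / (2 * B)) * B"
        using B K that by (intro mult_left_mono) auto
      also have "\<dots> < e" using B K by simp
      finally show ?thesis .
    qed
    then have "h \<in> T" using K(4) hH by (auto simp: basic_nbhd_def)
    moreover have "\<not> bounded (A h ` \<Omega>)"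
    proof
      assume "bounded (A h ` \<Omega>)"
      with True obtain b b' where b: "\<And>z. z \<in> \<Omega> \<Longrightarrow> norm (A f z) \<le> b" "\<And>z. z \<in> \<Omega> \<Longrightarrow> norm (A h z) \<le> b'"
        by (auto simp: bounded_iff)
      have "norm (A g z) \<le> (b' + b) / norm c" if z: "z \<in> \<Omega>" for z
      proof -
        have "A h z = A f z + c * A g z"
          using fhol g(1) hhol z by (intro hol_linear_add[OF A]) (auto simp: h_def)
        then have "norm c * norm (A g z) = norm (A h z - A f z)" by (simp add: norm_mult)
        also have "\<dots> \<le> b' + b"
          using b[OF z] norm_triangle_ineq4[of "A h z" "A f z"] by linarith
        finally show ?thesis using c by (simp add: field_simps)
      qed
      then show False using g(2) by (auto simp: bounded_iff)
    qed
    ultimately show ?thesis using hH by blast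
  qed
qed

section \<open>Functions with unbounded derivatives or integrals\<close>

text \<open>Adjacent pairs \<open>deriv\<close> and \<open>T_op\<close> cancel from the middle
  outwards. They cancel only on \<open>\<Omega>\<close>, so the remaining derivatives are carried
  over by \<open>hol_linear_cong\<close>.\<close>

lemma deriv_funpow_T_op_funpow:
  assumes "open \<Omega>" "simply_connected \<Omega>" "\<zeta>0 \<in> \<Omega>" "f holomorphic_on \<Omega>" "z \<in> \<Omega>"
  shows "(deriv ^^ n) ((T_op \<Omega> \<zeta>0 ^^ n) f) z = f z"
  using assms(5)
proof (induction n arbitrary: z)
  case (Suc n)
  note T = hol_linear_T_op[OF assms(1-3)]
  let ?g = "(T_op \<Omega> \<zeta>0 ^^ n) f"
  have g: "?g holomorphic_on \<Omega>"
    using hol_linear_holomorphic[OF hol_linear_funpow[OF T] assms(4)] .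
  have "(deriv ^^ Suc n) ((T_op \<Omega> \<zeta>0 ^^ Suc n) f) z = (deriv ^^ n) (deriv (T_op \<Omega> \<zeta>0 ?g)) z"
    by (simp add: funpow_swap1)
  also have "\<dots> = (deriv ^^ n) ?g z"
  proof (rule hol_linear_cong[OF hol_linear_funpow[OF hol_linear_deriv[OF assms(1)]]])
    show "deriv (T_op \<Omega> \<zeta>0 ?g) holomorphic_on \<Omega>"
      using hol_linear_holomorphic[OF T g] assms(1) by (rule holomorphic_deriv)
    show "deriv (T_op \<Omega> \<zeta>0 ?g) w = ?g w" if "w \<in> \<Omega>" for w
      using T_op_has_field_derivative[OF assms(1-3) g that] by (rule DERIV_imp_deriv)
  qed (use g Suc.prems in auto)
  finally show ?case using Suc by simp
qed simp

text \<open>Integrating \<open>deriv h\<close> from \<open>\<zeta>0\<close> gives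
  \<open>h - h \<zeta>0\<close>, and the zero removes the constant. The holomorphic cofactor
  \<open>u\<close> expresses the order of the zero in a form that survives differentiation with the
  order lowered by one.\<close>

lemma T_op_funpow_deriv_funpow:
  assumes "open \<Omega>" "simply_connected \<Omega>" "\<zeta>0 \<in> \<Omega>"
    and "h holomorphic_on \<Omega>" "u holomorphic_on \<Omega>"
    and "\<And>z. z \<in> \<Omega> \<Longrightarrow> h z = (z - \<zeta>0) ^ n * u z" "z \<in> \<Omega>"
  shows "(T_op \<Omega> \<zeta>0 ^^ n) ((deriv ^^ n) h) z = h z"
  using assms(4-)
proof (induction n arbitrary: h u z)
  case (Suc n)
  note T = hol_linear_T_op[OF assms(1-3)]
  have con: "connected \<Omega>" using assms(2) by (rule simply_connected_imp_connected)
  note dh = holomorphic_deriv[OF Suc.prems(1) assms(1)]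
  have IH: "(T_op \<Omega> \<zeta>0 ^^ n) ((deriv ^^ n) (deriv h)) w = deriv h w" if "w \<in> \<Omega>" for w
  proof (rule Suc.IH[OF dh _ _ that])
    \<comment> \<open>The new cofactor, left after \<open>(z - \<zeta>0) ^ n\<close> is taken out of
      the product rule for \<open>(z - \<zeta>0) ^ Suc n * u z\<close>.\<close>
    show "(\<lambda>z. of_nat (Suc n) * u z + (z - \<zeta>0) * deriv u z) holomorphic_on \<Omega>"
      using Suc.prems(2) assms(1) by (intro holomorphic_intros)
    fix z assume z: "z \<in> \<Omega>"
    have "((\<lambda>z. (z - \<zeta>0) ^ Suc n * u z) has_field_derivative
             (z - \<zeta>0) ^ n * (of_nat (Suc n) * u z + (z - \<zeta>0) * deriv u z)) (at z)"
    proof -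
      have "((\<lambda>z. z - \<zeta>0) has_field_derivative 1) (at z)"
        by (auto intro!: derivative_eq_intros)
      from DERIV_mult[OF DERIV_power[OF this, of "Suc n"] holomorphic_derivI[OF Suc.prems(2) assms(1) z]]
      show ?thesis by (simp add: algebra_simps)
    qed
    then have "(h has_field_derivative
             (z - \<zeta>0) ^ n * (of_nat (Suc n) * u z + (z - \<zeta>0) * deriv u z)) (at z)"
      by (rule has_field_derivative_transform_within_open[OF _ assms(1) z]) (use Suc.prems(3) in auto)
    then show "deriv h z = (z - \<zeta>0) ^ n * (of_nat (Suc n) * u z + (z - \<zeta>0) * deriv u z)"
      by (rule DERIV_imp_deriv)
  qed
  have "(T_op \<Omega> \<zeta>0 ^^ Suc n) ((deriv ^^ Suc n) h) z
      = T_op \<Omega> \<zeta>0 ((T_op \<Omega> \<zeta>0 ^^ n) ((deriv ^^ n) (deriv h))) z"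
    by (simp add: funpow_swap1)
  also have "\<dots> = T_op \<Omega> \<zeta>0 (deriv h) z"
    using hol_linear_holomorphic[OF hol_linear_funpow[OF T]
        hol_linear_holomorphic[OF hol_linear_funpow[OF hol_linear_deriv[OF assms(1)]] dh]]
    by (intro hol_linear_cong[OF T dh _ IH Suc.prems(4)]) auto
  also have "\<dots> = h z - h \<zeta>0"
    using holomorphic_derivI[OF Suc.prems(1) assms(1)]
    by (intro T_op_of_primitive[OF assms(1) con assms(3) Suc.prems(4)])
  also have "h \<zeta>0 = 0" using Suc.prems(3)[OF assms(3)] by simp
  finally show ?case by simp
qed simp

text \<open>For unbounded \<open>\<Omega>\<close> the product is a power of
  \<open>z - \<zeta>0\<close> with positive exponent. For bounded \<open>\<Omega>\<close> the
  boundary point \<open>a\<close> differs from \<open>\<zeta>0\<close> because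
  \<open>\<Omega>\<close> is open, so near \<open>a\<close> the numerator stays away from 0 while
  the denominator tends to 0.\<close>

lemma unbounded_zero_of_order:
  assumes "open \<Omega>" "\<zeta>0 \<in> \<Omega>"
  obtains u where "u holomorphic_on \<Omega>" "\<not> bounded ((\<lambda>z. (z - \<zeta>0) ^ n * u z) ` \<Omega>)"
proof (cases "bounded \<Omega>")
  case False
  show ?thesis
  proof (rule that[of "\<lambda>z. z - \<zeta>0"])
    show "\<not> bounded ((\<lambda>z. (z - \<zeta>0) ^ n * (z - \<zeta>0)) ` \<Omega>)"
    proof
      assume "bounded ((\<lambda>z. (z - \<zeta>0) ^ n * (z - \<zeta>0)) ` \<Omega>)"
      then obtain b where b: "\<And>z. z \<in> \<Omega> \<Longrightarrow> norm (z - \<zeta>0) ^ Suc n \<le> b"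
        by (auto simp: bounded_iff norm_mult norm_power mult.commute)
      have "norm z \<le> norm \<zeta>0 + max 1 b" if "z \<in> \<Omega>" for z
      proof -
        \<comment> \<open>A higher power dominates the norm only where the norm exceeds 1, hence the
          maximum.\<close>
        have "norm (z - \<zeta>0) \<le> max 1 b"
        proof (cases "norm (z - \<zeta>0) \<le> 1")
          case False
          then have "norm (z - \<zeta>0) ^ 1 \<le> norm (z - \<zeta>0) ^ Suc n"
            by (intro power_increasing) auto
          then show ?thesis using b[OF that] by simp
        qed simp
        then show ?thesis using norm_triangle_sub[of z \<zeta>0] by linarith
      qed
      then show False using False by (auto simp: bounded_iff)
    qed
  qed (intro holomorphic_intros)
next
  case True
  then have "frontier \<Omega> \<noteq> {}"
    using assms(2) frontier_not_empty by (metis empty_iff not_bounded_UNIV)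
  then obtain a where a: "a \<in> frontier \<Omega>" by blast
  then have "a \<notin> \<Omega>" "a \<in> closure \<Omega>"
    using assms(1) by (auto simp: frontier_def interior_open)
  then have ne: "a \<noteq> \<zeta>0" using assms(2) by blast
  show ?thesis
  proof (rule that[of "\<lambda>z. 1 / (z - a)"])
    show "(\<lambda>z. 1 / (z - a)) holomorphic_on \<Omega>"
      using \<open>a \<notin> \<Omega>\<close> by (intro holomorphic_intros) auto
    show "\<not> bounded ((\<lambda>z. (z - \<zeta>0) ^ n * (1 / (z - a))) ` \<Omega>)"
    proof
      assume "bounded ((\<lambda>z. (z - \<zeta>0) ^ n * (1 / (z - a))) ` \<Omega>)"
      then obtain b where "b > 0" and b: "\<And>z. z \<in> \<Omega> \<Longrightarrow> norm (z - \<zeta>0) ^ n / norm (z - a) \<le> b"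
        by (auto simp: bounded_pos norm_mult norm_power norm_divide)
      \<comment> \<open>With half the distance from \<open>a\<close> to \<open>\<zeta>0\<close>, any
        \<open>z\<close> within \<open>q\<close> of \<open>a\<close> has distance at least
        \<open>q\<close> from \<open>\<zeta>0\<close>, so the numerator is at least
        \<open>q ^ n\<close>. The second bound in \<open>\<delta>\<close> then contradicts
        \<open>b\<close>.\<close>
      define q where "q = norm (a - \<zeta>0) / 2"
      have q: "q > 0" using ne by (simp add: q_def)
      define \<delta> where "\<delta> = min q (q ^ n / b)"
      have "\<delta> > 0" using q \<open>b > 0\<close> by (simp add: \<delta>_def)
      then obtain z where z: "z \<in> \<Omega>" "dist z a < \<delta>"
        using \<open>a \<in> closure \<Omega>\<close> closure_approachable by blast
      have za: "norm (z - a) > 0" using z \<open>a \<notin> \<Omega>\<close> by auto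
      have zd: "norm (z - a) < q" "norm (z - a) < q ^ n / b"
        using z by (auto simp: \<delta>_def dist_norm)
      have "2 * q \<le> norm (z - a) + norm (z - \<zeta>0)"
        unfolding q_def using norm_triangle_ineq4[of "z - \<zeta>0" "z - a"] by simp
      then have "q ^ n \<le> norm (z - \<zeta>0) ^ n" using zd q by (intro power_mono) auto
      also have "\<dots> \<le> b * norm (z - a)" using b[OF z(1)] za by (simp add: field_simps)
      also have "\<dots> < q ^ n" using zd(2) \<open>b > 0\<close> by (simp add: field_simps)
      finally show False by simp
    qed
  qed
qed

lemma int_deriv_unbounded_witness:
  assumes "open \<Omega>" "simply_connected \<Omega>" "\<zeta>0 \<in> \<Omega>"
  obtains g where "g holomorphic_on \<Omega>" "\<not> bounded (int_deriv \<Omega> \<zeta>0 k g ` \<Omega>)"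
proof (cases "k \<ge> 0")
  case True
  \<comment> \<open>With exponent 0 no zero is imposed: any unbounded holomorphic function will
    do.\<close>
  obtain u where u: "u holomorphic_on \<Omega>" "\<not> bounded ((\<lambda>z. (z - \<zeta>0) ^ 0 * u z) ` \<Omega>)"
    using unbounded_zero_of_order[OF assms(1,3)] .
  let ?g = "(T_op \<Omega> \<zeta>0 ^^ nat k) u"
  have "int_deriv \<Omega> \<zeta>0 k ?g ` \<Omega> = u ` \<Omega>"
    using True deriv_funpow_T_op_funpow[OF assms u(1)] by (simp add: int_deriv_def)
  moreover have "?g holomorphic_on \<Omega>"
    using hol_linear_holomorphic[OF hol_linear_funpow[OF hol_linear_T_op[OF assms]] u(1)] .
  ultimately show ?thesis using that u(2) by simp
next
  case False
  define n where "n = nat (- k)"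
  obtain u where u: "u holomorphic_on \<Omega>" "\<not> bounded ((\<lambda>z. (z - \<zeta>0) ^ n * u z) ` \<Omega>)"
    using unbounded_zero_of_order[OF assms(1,3)] .
  define h where "h = (\<lambda>z. (z - \<zeta>0) ^ n * u z)"
  have h: "h holomorphic_on \<Omega>"
    unfolding h_def using u(1) by (intro holomorphic_intros)
  have "int_deriv \<Omega> \<zeta>0 k ((deriv ^^ n) h) ` \<Omega> = h ` \<Omega>"
    using False T_op_funpow_deriv_funpow[OF assms h u(1), of n] by (simp add: int_deriv_def n_def h_def)
  moreover have "(deriv ^^ n) h holomorphic_on \<Omega>"
    using hol_linear_holomorphic[OF hol_linear_funpow[OF hol_linear_deriv[OF assms(1)]] h] .
  ultimately show ?thesis using that u(2) by (simp add: h_def)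
qed

section \<open>The countable intersection\<close>

theorem theorem3p8:
  fixes \<Omega> :: "complex set" and \<zeta>0 :: complex
  assumes "open \<Omega>" and "connected \<Omega>" and "\<Omega> \<noteq> {}" and "simply_connected \<Omega>"
    and "\<zeta>0 \<in> \<Omega>"
  shows "gdelta_in (Hol_topology \<Omega>) (unbounded_all_orders \<Omega> \<zeta>0) \<and>
         (Hol_topology \<Omega>) closure_of (unbounded_all_orders \<Omega> \<zeta>0) = topspace (Hol_topology \<Omega>)"
proof -
  define V where "V k n = {f \<in> Hol \<Omega>. \<exists>z\<in>\<Omega>. real n < norm (int_deriv \<Omega> \<zeta>0 k f z)}" for k n
  define \<V> where "\<V> = range (\<lambda>(k, n). V k n)"
  note lin = hol_linear_int_deriv[OF assms(1,4,5)]
  have V_open: "openin (Hol_topology \<Omega>) (V k n)" for k n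
    unfolding V_def by (rule openin_hol_linear_large[OF lin])
  \<comment> \<open>Testing against natural numbers only is what keeps the family
    \<open>\<V>\<close> countable.\<close>
  have unbdd_iff: "\<not> bounded (S :: complex set) \<longleftrightarrow> (\<forall>n. \<exists>w\<in>S. real n < norm w)" for S
  proof
    show "\<forall>n. \<exists>w\<in>S. real n < norm w" if "\<not> bounded S"
      using that unfolding bounded_iff by (meson not_le)
    show "\<not> bounded S" if "\<forall>n. \<exists>w\<in>S. real n < norm w"
    proof
      assume "bounded S"
      then obtain b where b: "\<And>w. w \<in> S \<Longrightarrow> norm w \<le> b" by (auto simp: bounded_iff)
      obtain n where "b < real n" using reals_Archimedean2 by blast
      then show False using that b by (meson not_le order.strict_trans2 order.strict_trans)
    qed
  qed
  have eq: "unbounded_all_orders \<Omega> \<zeta>0 = \<Inter>\<V>"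
    by (auto simp: unbounded_all_orders_def \<V>_def V_def unbdd_iff)
  have countable: "countable \<V>" "\<V> \<noteq> {}"
    by (auto simp: \<V>_def)
  have "Hol_topology \<Omega> closure_of V k n = topspace (Hol_topology \<Omega>)" for k n
  proof -
    obtain g where "g holomorphic_on \<Omega>" "\<not> bounded (int_deriv \<Omega> \<zeta>0 k g ` \<Omega>)"
      using int_deriv_unbounded_witness[OF assms(1,4,5)] .
    then have dense: "Hol_topology \<Omega> closure_of {f \<in> Hol \<Omega>. \<not> bounded (int_deriv \<Omega> \<zeta>0 k f ` \<Omega>)}
        = topspace (Hol_topology \<Omega>)"
      by (rule dense_hol_linear_unbounded[OF lin])
    \<comment> \<open>For fixed \<open>k\<close>, one dense set lies in \<open>V k n\<close> for
      every \<open>n\<close>, so a single witness \<open>g\<close> settles all the bounds at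
      once.\<close>
    have "{f \<in> Hol \<Omega>. \<not> bounded (int_deriv \<Omega> \<zeta>0 k f ` \<Omega>)} \<subseteq> V k n"
      by (auto simp: V_def unbdd_iff)
    from closure_of_mono[OF this, of "Hol_topology \<Omega>"] show ?thesis
      unfolding dense by (intro subset_antisym closure_of_subset_topspace)
  qed
  then have "Hol_topology \<Omega> closure_of (Hol \<Omega> \<inter> \<Inter>\<V>) = topspace (Hol_topology \<Omega>)"
    using V_open by (intro Hol_Baire assms countable) (auto simp: \<V>_def)
  moreover have "Hol \<Omega> \<inter> \<Inter>\<V> = \<Inter>\<V>"
    unfolding eq[symmetric] by (auto simp: unbounded_all_orders_def)
  moreover have "gdelta_in (Hol_topology \<Omega>) (\<Inter>\<V>)"
    using V_open by (intro gdelta_in_Inter countable open_imp_gdelta_in) (auto simp: \<V>_def)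
  ultimately show ?thesis
    unfolding eq by simp
qed

end
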